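(* Let $m\in\mathbb{N}$, $[a,b]\subset[0,1]$, $\kappa>1$, let $f$ be continuous on $[a,b]$, let $g$ be continuously differentiable and strictly increasing on $[a,b]$ with no stationary point in $[a,b]$, and let $\sigma:=\max_{x\in[a,b]}|g'(x)|$. If $\Psi:=(f/g')\circ g^{-1}\in C^{m+1}[g(a),g(b)]$, then for every $N\in\mathbb{N}$ $$\left|\mathcal{I}_\kappa^{[a,b]}[f,g]-\mathcal{Q}^{[a,b]}_{N,\kappa,m}[f,g]\right|\le \frac{3(m+1)}{m!\,\kappa^2N^{m-1}}\,\|\Psi^{(m+1)}\|_\infty\,\sigma^m(b-a)^m ,$$ and $\mathcal{N}\big(\mathcal{Q}^{[a,b]}_{N,\kappa,m}[f,g]\big)\le Nm+1$. In particular, if $N=\lceil\sigma\rceil$ (the smallest integer not less than $\sigma$), then $$\left|\mathcal{I}_\kappa^{[a,b]}[f,g]-\mathcal{Q}^{[a,b]}_{N,\kappa,m}[f,g]\right|\le \frac{3(m+1)}{m!\,\kappa^2}\,\|\Psi^{(m+1)}\|_\infty\,\sigma\,(b-a)^m .$$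
   Context: $\mathbb{N}=\{1,2,\dots\}$. $\|\cdot\|_\infty$ is the maximum norm on the relevant interval. $\mathcal{I}_\kappa^{[a,b]}[f,g]:=\int_a^b f(x)e^{\mathrm{i}\kappa g(x)}\,dx$. Basic Filon-type rule. For an interval $[a,b]$ and $m\in\mathbb{N}$, choose (arbitrary) nodes $a=t_0<t_1<\dots<t_m=b$ and let $p_m$ be the polynomial of degree at most $m$ with $p_m(g(t_j))=\Psi(g(t_j))$, $j=0,\dots,m$. Put $\mathcal{Q}^{[a,b]}_{\kappa,m}[f,g]:=\int_{g(a)}^{g(b)}p_m(x)e^{\mathrm{i}\kappa x}\,dx$. Composite version. For $N\in\mathbb{N}$ let $y_j:=a+(b-a)j/N$, $j=0,\dots,N$, and $\mathcal{Q}^{[a,b]}_{N,\kappa,m}[f,g]:=\sum_{j=1}^{N}\mathcal{Q}^{[y_{j-1},y_j]}_{\kappa,m}[f,g]$. $\mathcal{N}(F)$ denotes the number of evaluations of $\Psi$ used in the quadrature formula $F$ (an evaluation at an endpoint shared by two subintervals is counted once). *)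

theory Defs
  imports "HOL-Analysis.Analysis" "HOL-Computational_Algebra.Polynomial"
begin

text \<open>Derivatives are taken within the set, hence one-sided at the endpoints of a closed
  interval.  On a nondegenerate interval \<open>vector_derivative\<close> is the usual derivative wherever
  it exists.\<close>

primrec nth_deriv_on ::
    "nat \<Rightarrow> real set \<Rightarrow> (real \<Rightarrow> 'a::real_normed_vector) \<Rightarrow> real \<Rightarrow> 'a" where
  "nth_deriv_on 0 S h = h"
| "nth_deriv_on (Suc k) S h = (\<lambda>x. vector_derivative (nth_deriv_on k S h) (at x within S))"

definition C_k_on :: "nat \<Rightarrow> real set \<Rightarrow> (real \<Rightarrow> 'a::real_normed_vector) \<Rightarrow> bool" where
  "C_k_on k S h \<longleftrightarrow>
     (\<forall>i<k. \<forall>x\<in>S. nth_deriv_on i S h differentiable (at x within S)) \<and>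
     continuous_on S (nth_deriv_on k S h)"

text \<open>Only applied to continuous functions on compact intervals, where the supremum is attained.\<close>

definition max_norm :: "real set \<Rightarrow> (real \<Rightarrow> 'a::real_normed_vector) \<Rightarrow> real" where
  "max_norm S h = (SUP x\<in>S. norm (h x))"

definition osc_integral ::
    "real \<Rightarrow> real \<Rightarrow> real \<Rightarrow> (real \<Rightarrow> complex) \<Rightarrow> (real \<Rightarrow> real) \<Rightarrow> complex" where
  "osc_integral \<kappa> a b f g =
     integral {a..b} (\<lambda>x. f x * exp (\<i> * complex_of_real (\<kappa> * g x)))"

text \<open>The function \<open>\<Psi> = (f / g') \<circ> g\<^sup>-\<^sup>1\<close>, with \<open>g\<close> inverted on \<open>[a, b]\<close>; meaningful on \<open>[g a, g b]\<close>.\<close>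

definition filon_amplitude ::
    "real \<Rightarrow> real \<Rightarrow> (real \<Rightarrow> complex) \<Rightarrow> (real \<Rightarrow> real) \<Rightarrow> real \<Rightarrow> complex" where
  "filon_amplitude a b f g =
     (\<lambda>x. f x / complex_of_real (nth_deriv_on 1 {a..b} g x)) \<circ> inv_into {a..b} g"

definition filon_nodes :: "nat \<Rightarrow> real \<Rightarrow> real \<Rightarrow> (nat \<Rightarrow> real) \<Rightarrow> bool" where
  "filon_nodes m a b t \<longleftrightarrow> t 0 = a \<and> t m = b \<and> (\<forall>i<m. t i < t (Suc i))"

text \<open>The points at which a basic rule with nodes \<open>t\<close> evaluates \<open>\<Psi>\<close>.\<close>

definition eval_points :: "nat \<Rightarrow> (nat \<Rightarrow> real) \<Rightarrow> (real \<Rightarrow> real) \<Rightarrow> real set" where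
  "eval_points m t g = (\<lambda>i. g (t i)) ` {..m}"

text \<open>Unique whenever \<open>X\<close> has \<open>m + 1\<close> elements.\<close>

definition interp_poly :: "nat \<Rightarrow> real set \<Rightarrow> (real \<Rightarrow> complex) \<Rightarrow> complex poly" where
  "interp_poly m X \<Psi> =
     (THE p. degree p \<le> m \<and> (\<forall>x\<in>X. poly p (complex_of_real x) = \<Psi> x))"

definition filon_rule ::
    "real \<Rightarrow> nat \<Rightarrow> real \<Rightarrow> real \<Rightarrow> (nat \<Rightarrow> real) \<Rightarrow>
     (real \<Rightarrow> complex) \<Rightarrow> (real \<Rightarrow> real) \<Rightarrow> complex" where
  "filon_rule \<kappa> m a b t f g =
     integral {g a..g b}
       (\<lambda>x. poly (interp_poly m (eval_points m t g) (filon_amplitude a b f g)) (complex_of_real x)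
            * exp (\<i> * complex_of_real (\<kappa> * x)))"

definition uniform_mesh :: "real \<Rightarrow> real \<Rightarrow> nat \<Rightarrow> nat \<Rightarrow> real" where
  "uniform_mesh a b N j = a + (b - a) * real j / real N"

text \<open>In the composite rule \<open>t j\<close> are the nodes chosen on the \<open>j\<close>-th subinterval, \<open>1 \<le> j \<le> N\<close>;
  the choices on different subintervals are independent.\<close>

definition composite_nodes ::
    "nat \<Rightarrow> nat \<Rightarrow> real \<Rightarrow> real \<Rightarrow> (nat \<Rightarrow> nat \<Rightarrow> real) \<Rightarrow> bool" where
  "composite_nodes N m a b t \<longleftrightarrow>
     (\<forall>j\<in>{1..N}. filon_nodes m (uniform_mesh a b N (j - 1)) (uniform_mesh a b N j) (t j))"

definition composite_filon_rule ::
    "nat \<Rightarrow> real \<Rightarrow> nat \<Rightarrow> real \<Rightarrow> real \<Rightarrow> (nat \<Rightarrow> nat \<Rightarrow> real) \<Rightarrow>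
     (real \<Rightarrow> complex) \<Rightarrow> (real \<Rightarrow> real) \<Rightarrow> complex" where
  "composite_filon_rule N \<kappa> m a b t f g =
     (\<Sum>j=1..N. filon_rule \<kappa> m (uniform_mesh a b N (j - 1)) (uniform_mesh a b N j) (t j) f g)"

text \<open>The number of evaluations of \<open>\<Psi>\<close>: taking the union identifies the evaluations at an
  endpoint shared by two subintervals, and no others.\<close>

definition composite_eval_count ::
    "nat \<Rightarrow> nat \<Rightarrow> (nat \<Rightarrow> nat \<Rightarrow> real) \<Rightarrow> (real \<Rightarrow> real) \<Rightarrow> nat" where
  "composite_eval_count N m t g = card (\<Union>j\<in>{1..N}. eval_points m (t j) g)"

end

theory Submission
  imports Defs
begin

text \<open>After the substitution by \<open>g\<close>, the error on a subinterval of image \<open>[c, d]\<close> of length \<open>L\<close> is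
  the integral of \<open>h(x) exp(i \<kappa> x)\<close> with \<open>h = \<Psi> - p\<^sub>m\<close>. Since the endpoints are nodes, \<open>h\<close> vanishes
  there, and integrating by parts twice gives the bound
  \<open>(\<bar>h'(c)\<bar> + \<bar>h'(d)\<bar> + L sup \<bar>h''\<bar>) / \<kappa>\<^sup>2\<close>.
  By Rolle's theorem \<open>h'\<close> and \<open>h''\<close> interpolate zero at \<open>m\<close> and \<open>m - 1\<close> points, so with
  \<open>M = sup \<bar>\<Psi>\<^bsup>(m+1)\<^esup>\<bar>\<close> they are at most \<open>M L\<^sup>m / m!\<close> and \<open>M L\<^bsup>m-1\<^esup> / (m-1)!\<close>.
  This gives \<open>(m + 2) M L\<^sup>m / (m! \<kappa>\<^sup>2)\<close> with \<open>L \<le> \<sigma> (b - a) / N\<close>, and \<open>m + 2 \<le> 3 (m + 1)\<close>.\<close>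


section \<open>Zeros of derivatives and the interpolation error\<close>

text \<open>Induction that removes the largest zero. The bound \<open>Max Z\<close> in place of
  \<open>d\<close> makes it go through: the new zero lies between the two largest points of
  \<open>Z\<close>, beyond all those given by the induction hypothesis.\<close>

lemma Rolle_finite_zeros:
  fixes f f' :: "real \<Rightarrow> real"
  assumes "\<And>x. x \<in> {c..d} \<Longrightarrow> (f has_real_derivative f' x) (at x within {c..d})"
    and "Z \<subseteq> {c..d}" "card Z = Suc n" "\<And>z. z \<in> Z \<Longrightarrow> f z = 0"
  shows "\<exists>W. W \<subseteq> {c..Max Z} \<and> finite W \<and> card W = n \<and> (\<forall>w\<in>W. f' w = 0)"
  using assms(2-4)
proof (induction n arbitrary: Z)
  case 0
  show ?case by (intro exI[of _ "{}"]) auto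
next
  case (Suc n)
  have fin: "finite Z" using Suc.prems(2) card.infinite by fastforce
  let ?M = "Max Z" and ?Y = "Z - {Max Z}"
  have M: "?M \<in> Z" using fin Suc.prems(2) by (intro Max_in) auto
  have cY: "card ?Y = Suc n" using M Suc.prems(2) by simp
  then have "?Y \<noteq> {}" by (metis card.empty nat.distinct(1))
  then have Y: "Max ?Y \<in> ?Y" using fin by (intro Max_in) auto
  have less: "Max ?Y < ?M" using Y Max_ge[OF fin, of "Max ?Y"] by auto
  obtain W where W: "W \<subseteq> {c..Max ?Y}" "finite W" "card W = n" "\<forall>w\<in>W. f' w = 0"
    using Suc.IH[of ?Y] Suc.prems cY by blast
  have sub: "{Max ?Y..?M} \<subseteq> {c..d}" using Y M Suc.prems(1) by auto
  \<comment> \<open>Rolle's theorem asks for two-sided derivatives; a point strictly between two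
    elements of \<open>Z\<close> is interior to \<open>{c..d}\<close>.\<close>
  have der: "(f has_real_derivative f' x) (at x)" if "Max ?Y < x" "x < ?M" for x
  proof -
    have "x \<in> {c<..<d}" using that Y M Suc.prems(1) by force
    then show ?thesis using assms(1)[of x] at_within_Icc_at[of c x d] by auto
  qed
  have cont: "continuous_on {Max ?Y..?M} f"
    by (rule continuous_on_subset[OF _ sub]) (rule DERIV_continuous_on[OF assms(1)])
  have "f (Max ?Y) = f ?M" using Y M Suc.prems(3) by simp
  then obtain w where w: "Max ?Y < w" "w < ?M" "DERIV f w :> 0"
    using Rolle[OF less _ cont] der real_differentiable_def by blast
  have "f' w = 0" using DERIV_unique[OF der[OF w(1,2)] w(3)] .
  moreover have "w \<notin> W" using W(1) w(1) by auto
  moreover have "c \<le> Max ?Y" using Y Suc.prems(1) by auto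
  ultimately show ?case
    using W w less by (intro exI[of _ "insert w W"]) force
qed

text \<open>Every differentiation costs one zero. Passing the derivatives as a sequence
  \<open>D\<close> lets the lemma serve shifted sequences and real parts as well.\<close>

lemma Rolle_finite_zeros_iterated:
  fixes D :: "nat \<Rightarrow> real \<Rightarrow> real"
  assumes "\<And>i x. i < k \<Longrightarrow> x \<in> {c..d} \<Longrightarrow> (D i has_real_derivative D (Suc i) x) (at x within {c..d})"
    and "Z \<subseteq> {c..d}" "finite Z" "card Z = n + k" "\<And>z. z \<in> Z \<Longrightarrow> D 0 z = 0"
  shows "\<exists>W. W \<subseteq> {c..d} \<and> finite W \<and> card W = n \<and> (\<forall>w\<in>W. D k w = 0)"
  using assms
proof (induction k arbitrary: n)
  case 0
  then show ?case by auto
next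
  case (Suc k)
  obtain W where W: "W \<subseteq> {c..d}" "finite W" "card W = Suc n" "\<forall>w\<in>W. D k w = 0"
    using Suc.IH[of "Suc n"] Suc.prems by auto
  then have "Max W \<in> W" by (intro Max_in) auto
  then have "{c..Max W} \<subseteq> {c..d}" using W(1) by auto
  moreover obtain V where "V \<subseteq> {c..Max W}" "finite V" "card V = n" "\<forall>v\<in>V. D (Suc k) v = 0"
    using Rolle_finite_zeros[of c d "D k" "D (Suc k)" W n] Suc.prems(1)[of k] W by blast
  ultimately show ?case by (intro exI[of _ V]) auto
qed

text \<open>Cauchy's remainder argument: off \<open>Z\<close>, \<open>D 0 x\<close> equals
  \<open>D n y / n!\<close> times the node polynomial at \<open>x\<close> for some \<open>y\<close>,
  and each of the \<open>n\<close> factors of that polynomial is at most \<open>d - c\<close> in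
  absolute value.\<close>

lemma interpolation_error:
  fixes D :: "nat \<Rightarrow> real \<Rightarrow> real"
  assumes D: "\<And>i x. i < n \<Longrightarrow> x \<in> {c..d} \<Longrightarrow> (D i has_real_derivative D (Suc i) x) (at x within {c..d})"
    and Z: "Z \<subseteq> {c..d}" "finite Z" "card Z = n" "\<And>z. z \<in> Z \<Longrightarrow> D 0 z = 0"
    and M: "\<And>x. x \<in> {c..d} \<Longrightarrow> \<bar>D n x\<bar> \<le> M"
    and x: "x \<in> {c..d}"
  shows "\<bar>D 0 x\<bar> \<le> M * (d - c) ^ n / fact n"
proof (cases "x \<in> Z")
  case True
  have "0 \<le> M" using M[OF x] by linarith
  then show ?thesis using True Z(4) x by simp
next
  case False
  define w where "w = (\<Prod>z\<in>Z. [:- z, 1:])"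
  define K where "K = D 0 x / poly w x"
  have w0: "poly w y = 0 \<longleftrightarrow> y \<in> Z" for y
    using Z(2) by (auto simp: w_def poly_prod)
  have deg: "degree w = n"
    using Z(2,3) by (auto simp: w_def degree_prod_eq_sum_degree)
  have "lead_coeff w = 1" by (simp add: w_def lead_coeff_prod)
  then have "degree ((pderiv ^^ n) w) = 0" "coeff ((pderiv ^^ n) w) 0 = fact n"
    using deg by (simp_all add: degree_higher_pderiv coeff_higher_pderiv pochhammer_fact)
  then have wn: "poly ((pderiv ^^ n) w) y = fact n" for y
    by (auto elim!: degree_eq_zeroE)
  \<comment> \<open>\<open>K\<close> makes \<open>E 0\<close> vanish at \<open>x\<close> too, so \<open>E 0\<close> has \<open>n + 1\<close> zeros.\<close>
  define E where "E i y = D i y - K * poly ((pderiv ^^ i) w) y" for i y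
  have E: "(E i has_real_derivative E (Suc i) y) (at y within {c..d})"
    if "i < n" "y \<in> {c..d}" for i y
    unfolding E_def using D[OF that]
    by (auto intro!: derivative_eq_intros has_field_derivative_at_within[OF poly_DERIV])
  have "E 0 z = 0" if "z \<in> insert x Z" for z
    using that w0 Z(4) False by (auto simp: E_def K_def)
  \<comment> \<open>Of \<open>n + 1\<close> zeros, \<open>n\<close> differentiations leave one,
    hence the argument 1. At that point \<open>K * n!\<close> equals \<open>D n\<close>, which
    determines \<open>K\<close>.\<close>
  then obtain W where "W \<subseteq> {c..d}" "finite W" "card W = 1" "\<forall>w\<in>W. E n w = 0"
    using Rolle_finite_zeros_iterated[of n c d E "insert x Z" 1] E Z False x by auto
  then obtain y where y: "y \<in> {c..d}" "E n y = 0"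
    by (metis card_1_singletonE insertCI subset_eq)
  then have K: "K * fact n = D n y" by (simp add: E_def wn)
  have "\<bar>poly w x\<bar> = (\<Prod>z\<in>Z. \<bar>x - z\<bar>)" by (simp add: w_def poly_prod abs_prod)
  also have "\<dots> \<le> (\<Prod>z\<in>Z. d - c)" using Z(1) x by (intro prod_mono) fastforce
  finally have wx: "\<bar>poly w x\<bar> \<le> (d - c) ^ n" using Z(3) by simp
  have "D 0 x = D n y * poly w x / fact n"
    using w0[of x] False K by (simp add: K_def field_simps)
  then have "\<bar>D 0 x\<bar> = \<bar>D n y\<bar> * \<bar>poly w x\<bar> / fact n" by (simp add: abs_mult)
  also have "\<dots> \<le> M * (d - c) ^ n / fact n"
    using M[OF y(1)] wx by (intro divide_right_mono mult_mono) auto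
  finally show ?thesis .
qed

text \<open>Rolle's theorem fails for complex values; it is applied to the real part of \<open>u * D 0\<close>, where
  the rotation \<open>u\<close>, depending on \<open>x\<close>, makes \<open>u * D k x\<close> real and nonnegative.\<close>

lemma complex_interpolation_error:
  fixes D :: "nat \<Rightarrow> real \<Rightarrow> complex"
  assumes D: "\<And>i x. i < k + n \<Longrightarrow> x \<in> {c..d} \<Longrightarrow>
      (D i has_vector_derivative D (Suc i) x) (at x within {c..d})"
    and Z: "Z \<subseteq> {c..d}" "finite Z" "card Z = k + n" "\<And>z. z \<in> Z \<Longrightarrow> D 0 z = 0"
    and M: "\<And>x. x \<in> {c..d} \<Longrightarrow> norm (D (k + n) x) \<le> M"
    and x: "x \<in> {c..d}"
  shows "norm (D k x) \<le> M * (d - c) ^ n / fact n"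
proof -
  define u where "u = cnj (sgn (D k x))"
  \<comment> \<open>Not an equality: \<open>sgn 0 = 0\<close> makes \<open>u\<close> vanish when
    \<open>D k x = 0\<close>.\<close>
  have u: "norm u \<le> 1" by (simp add: u_def norm_sgn)
  define E where "E i y = Re (u * D i y)" for i y
  have E: "(E i has_real_derivative E (Suc i) y) (at y within {c..d})"
    if "i < k + n" "y \<in> {c..d}" for i y
    unfolding E_def has_real_derivative_iff_has_vector_derivative
    by (intro bounded_linear.has_vector_derivative[OF bounded_linear_Re]
        bounded_linear.has_vector_derivative[OF bounded_linear_mult_right] D that)
  obtain W where W: "W \<subseteq> {c..d}" "finite W" "card W = n" "\<forall>w\<in>W. E k w = 0"
    using Rolle_finite_zeros_iterated[of k c d E Z n] E Z by (auto simp: E_def)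
  have bd: "\<bar>E (k + n) y\<bar> \<le> M" if "y \<in> {c..d}" for y
  proof -
    have "\<bar>E (k + n) y\<bar> \<le> norm u * norm (D (k + n) y)"
      unfolding E_def by (metis abs_Re_le_cmod norm_mult)
    also have "\<dots> \<le> 1 * M" using u M[OF that] by (intro mult_mono) auto
    finally show ?thesis by simp
  qed
  have "u * D k x = norm (D k x)"
    by (cases "D k x = 0")
      (auto simp: u_def sgn_eq complex_norm_square[symmetric] power2_eq_square
        mult.commute[of "cnj _"] divide_simps)
  then have "norm (D k x) = \<bar>E (k + 0) x\<bar>" by (simp add: E_def)
  \<comment> \<open>The sequence restarts at \<open>E k\<close>, whose \<open>n\<close> zeros in
    \<open>W\<close> remain after \<open>k\<close> uses of Rolle's theorem.\<close>
  also have "\<dots> \<le> M * (d - c) ^ n / fact n"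
    using interpolation_error[of n c d "\<lambda>i. E (k + i)" W M x] E W bd x by auto
  finally show ?thesis .
qed

section \<open>Decay of oscillatory integrals\<close>

text \<open>The function \<open>F\<close> performs both integrations by parts at once:
  \<open>h * e + h'' * e / \<kappa>\<^sup>2\<close> integrates to \<open>F d - F c\<close>. As
  \<open>h\<close> vanishes at both ends, every remaining term carries the factor
  \<open>1 / \<kappa>\<^sup>2\<close>.\<close>

lemma oscillatory_integral_bound:
  fixes h h' h'' :: "real \<Rightarrow> complex"
  assumes cd: "c \<le> d" and \<kappa>: "0 < \<kappa>"
    and h: "\<And>x. x \<in> {c..d} \<Longrightarrow> (h has_vector_derivative h' x) (at x within {c..d})"
    and h': "\<And>x. x \<in> {c..d} \<Longrightarrow> (h' has_vector_derivative h'' x) (at x within {c..d})"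
    and zero: "h c = 0" "h d = 0"
    and B1: "\<And>x. x \<in> {c..d} \<Longrightarrow> norm (h' x) \<le> B1"
    and B2: "\<And>x. x \<in> {c..d} \<Longrightarrow> norm (h'' x) \<le> B2"
  shows "norm (integral {c..d} (\<lambda>x. h x * exp (\<i> * complex_of_real (\<kappa> * x))))
      \<le> (2 * B1 + B2 * (d - c)) / \<kappa>\<^sup>2"
proof -
  define e where "e x = exp (\<i> * complex_of_real (\<kappa> * x))" for x
  have ne: "norm (e x) = 1" for x by (simp add: e_def)
  have e: "(e has_vector_derivative \<i> * \<kappa> * e x) (at x within {c..d})" for x
  proof -
    have "((\<lambda>z. exp (\<i> * \<kappa> * z)) has_field_derivative \<i> * \<kappa> * e x) (at (complex_of_real x))"
      by (auto intro!: derivative_eq_intros simp: e_def mult.assoc)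
    moreover have "e = (\<lambda>x. exp (\<i> * \<kappa> * complex_of_real x))"
      by (simp add: fun_eq_iff e_def mult.assoc)
    ultimately show ?thesis using has_vector_derivative_real_field by blast
  qed
  \<comment> \<open>The antiderivative is chosen so that the contributions of \<open>h'\<close> cancel in its derivative.\<close>
  define F where "F x = (h x / (\<i> * \<kappa>) + h' x / \<kappa>\<^sup>2) * e x" for x
  have F: "(F has_vector_derivative h x * e x + h'' x * e x / \<kappa>\<^sup>2) (at x within {c..d})"
    if "x \<in> {c..d}" for x
  proof -
    have "(F has_vector_derivative ((h x / (\<i> * \<kappa>) + h' x / \<kappa>\<^sup>2) * (\<i> * \<kappa> * e x)
        + (h' x / (\<i> * \<kappa>) + h'' x / \<kappa>\<^sup>2) * e x)) (at x within {c..d})"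
      unfolding F_def using h[OF that] h'[OF that]
      by (intro has_vector_derivative_mult has_vector_derivative_add
          has_vector_derivative_divide e)
    moreover have "((h x / (\<i> * \<kappa>) + h' x / \<kappa>\<^sup>2) * (\<i> * \<kappa> * e x)
        + (h' x / (\<i> * \<kappa>) + h'' x / \<kappa>\<^sup>2) * e x) = h x * e x + h'' x * e x / \<kappa>\<^sup>2"
      using \<kappa> by (simp add: field_simps power2_eq_square)
    ultimately show ?thesis by simp
  qed
  have FI: "((\<lambda>x. h x * e x + h'' x * e x / \<kappa>\<^sup>2) has_integral (F d - F c)) {c..d}"
    by (rule fundamental_theorem_of_calculus[OF cd F])
  have "continuous_on {c..d} h"
    using h by (rule continuous_on_vector_derivative)
  moreover have "continuous_on {c..d} e"
    using e by (rule continuous_on_vector_derivative)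
  ultimately have hI: "((\<lambda>x. h x * e x) has_integral integral {c..d} (\<lambda>x. h x * e x)) {c..d}"
    by (intro integrable_integral integrable_continuous_interval continuous_on_mult)
  define J where "J = F d - F c - integral {c..d} (\<lambda>x. h x * e x)"
  \<comment> \<open>Integrability of this term results from the subtraction: the sum has the
    antiderivative \<open>F\<close>, and \<open>h * e\<close> is continuous.\<close>
  have J: "((\<lambda>x. h'' x * e x / \<kappa>\<^sup>2) has_integral J) {c..d}"
    using has_integral_diff[OF FI hI] by (simp add: J_def)
  have B20: "0 \<le> B2" using B2[of c] cd by (auto intro: order_trans[OF norm_ge_zero])
  have "norm (h'' x * e x / \<kappa>\<^sup>2) \<le> B2 / \<kappa>\<^sup>2" if "x \<in> {c..d}" for x
    using B2[OF that] by (simp add: norm_mult norm_divide norm_power ne divide_right_mono)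
  then have "norm J \<le> B2 / \<kappa>\<^sup>2 * (d - c)"
    using has_integral_bound_real[OF _ finite.emptyI J, of "B2 / \<kappa>\<^sup>2"] B20 cd by simp
  moreover have "norm (F x) \<le> B1 / \<kappa>\<^sup>2" if "x \<in> {c, d}" for x
    using that zero B1[of x] cd by (auto simp: F_def norm_mult norm_divide norm_power ne divide_right_mono)
  then have "norm (F d) \<le> B1 / \<kappa>\<^sup>2" "norm (F c) \<le> B1 / \<kappa>\<^sup>2" by auto
  moreover have "integral {c..d} (\<lambda>x. h x * e x) = F d - F c - J" by (simp add: J_def)
  then have "norm (integral {c..d} (\<lambda>x. h x * e x)) \<le> norm (F d) + norm (F c) + norm J"
    using norm_triangle_ineq4[of "F d - F c" J] norm_triangle_ineq4[of "F d" "F c"] by simp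
  ultimately have "norm (integral {c..d} (\<lambda>x. h x * e x)) \<le> B1 / \<kappa>\<^sup>2 + B1 / \<kappa>\<^sup>2 + B2 / \<kappa>\<^sup>2 * (d - c)"
    by linarith
  also have "\<dots> = (2 * B1 + B2 * (d - c)) / \<kappa>\<^sup>2" by (simp add: add_divide_distrib)
  finally show ?thesis by (simp add: e_def)
qed

section \<open>Interpolating polynomials\<close>

text \<open>Newton's construction: a multiple of the node polynomial \<open>w\<close> corrects the
  value at the new node and leaves the old ones unchanged. For empty \<open>X\<close> the truncated
  difference \<open>card X - 1\<close> is 0.\<close>

lemma exists_interpolating_poly:
  fixes y :: "'a::field \<Rightarrow> 'a"
  assumes "finite X"
  shows "\<exists>p. degree p \<le> card X - 1 \<and> (\<forall>x\<in>X. poly p x = y x)"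
  using assms
proof induction
  case empty
  show ?case by (intro exI[of _ 0]) auto
next
  case (insert z X)
  then obtain p where p: "degree p \<le> card X - 1" "\<forall>x\<in>X. poly p x = y x" by blast
  define w where "w = (\<Prod>x\<in>X. [:- x, 1:])"
  have w0: "poly w v = 0 \<longleftrightarrow> v \<in> X" for v
    using insert.hyps by (auto simp: w_def poly_prod)
  have deg: "degree w = card X"
    by (simp add: w_def degree_prod_eq_sum_degree)
  define q where "q = p + smult ((y z - poly p z) / poly w z) w"
  have "degree q \<le> card X"
    unfolding q_def using p(1) deg
    by (intro degree_add_le order_trans[OF degree_smult_le]) auto
  moreover have "poly q x = y x" if "x \<in> insert z X" for x
    using that p(2) w0 insert.hyps by (auto simp: q_def)
  ultimately show ?case using insert.hyps by auto
qed

text \<open>The definite description in \<open>interp_poly\<close> needs existence and uniqueness;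
  two polynomials of degree at most \<open>m\<close> that agree at \<open>m + 1\<close> points
  coincide.\<close>

lemma interp_poly_properties:
  assumes "card X = m + 1"
  shows "degree (interp_poly m X \<Psi>) \<le> m"
    and "x \<in> X \<Longrightarrow> poly (interp_poly m X \<Psi>) (complex_of_real x) = \<Psi> x"
proof -
  have fin: "finite X" using assms card.infinite by fastforce
  let ?X = "complex_of_real ` X"
  have card: "card ?X = m + 1" using assms by (simp add: card_image inj_on_def)
  let ?P = "\<lambda>p. degree p \<le> m \<and> (\<forall>x\<in>X. poly p (complex_of_real x) = \<Psi> x)"
  obtain p where p: "?P p"
    \<comment> \<open>The real nodes are embedded in the complex field, where \<open>Re\<close>
      recovers them.\<close>
    using exists_interpolating_poly[of ?X "\<lambda>z. \<Psi> (Re z)"] fin card by auto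
  have "q = p" if "?P q" for q
    by (rule poly_eqI_degree[of ?X]) (use p that card in auto)
  then have "?P (interp_poly m X \<Psi>)"
    unfolding interp_poly_def using p theI[of ?P p] by blast
  then show "degree (interp_poly m X \<Psi>) \<le> m"
    and "x \<in> X \<Longrightarrow> poly (interp_poly m X \<Psi>) (complex_of_real x) = \<Psi> x" by auto
qed


section \<open>The error on one interval after substitution\<close>

text \<open>Here \<open>{c..d}\<close> stands for the image of a subinterval under \<open>g\<close>,
  and \<open>D 0\<close> for \<Psi>. With \<open>D\<close> given as a sequence, derivatives of
  \<Psi> taken within the whole image can be used on a part of it.\<close>

lemma filon_interval_error:
  fixes D :: "nat \<Rightarrow> real \<Rightarrow> complex"
  assumes m: "1 \<le> m" and cd: "c \<le> d" and \<kappa>: "0 < \<kappa>"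
    and D: "\<And>i x. i < m + 1 \<Longrightarrow> x \<in> {c..d} \<Longrightarrow>
      (D i has_vector_derivative D (Suc i) x) (at x within {c..d})"
    and M: "\<And>x. x \<in> {c..d} \<Longrightarrow> norm (D (m + 1) x) \<le> M"
    and X: "X \<subseteq> {c..d}" "card X = m + 1" "c \<in> X" "d \<in> X"
    and p: "degree p \<le> m" "\<And>x. x \<in> X \<Longrightarrow> poly p (complex_of_real x) = D 0 x"
  shows "norm (integral {c..d} (\<lambda>x. D 0 x * exp (\<i> * complex_of_real (\<kappa> * x)))
      - integral {c..d} (\<lambda>x. poly p (complex_of_real x) * exp (\<i> * complex_of_real (\<kappa> * x))))
    \<le> (real m + 2) / (fact m * \<kappa>\<^sup>2) * M * (d - c) ^ m"
proof -
  define H where "H i x = D i x - poly ((pderiv ^^ i) p) (complex_of_real x)" for i x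
  have H: "(H i has_vector_derivative H (Suc i) x) (at x within {c..d})"
    if "i < m + 1" "x \<in> {c..d}" for i x
    unfolding H_def using has_vector_derivative_real_field[OF poly_DERIV]
    by (intro has_vector_derivative_diff D that) simp
  have fin: "finite X" using X(2) card.infinite by fastforce
  have "(pderiv ^^ (m + 1)) p = 0"
    using p(1) by (intro poly_eqI) (simp add: coeff_higher_pderiv coeff_eq_0 del: funpow.simps)
  then have HM: "norm (H (m + 1) x) \<le> M" if "x \<in> {c..d}" for x
    using M[OF that] by (simp add: H_def del: funpow.simps)
  have H0: "H 0 x = 0" if "x \<in> X" for x using p(2)[OF that] by (simp add: H_def)
  have bound: "norm (H k x) \<le> M * (d - c) ^ n / fact n"
    if "k + n = m + 1" "x \<in> {c..d}" for k n x
    using that X fin H H0 HM by (intro complex_interpolation_error[of k n c d H X]) auto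
  \<comment> \<open>The number \<open>l = m - 1\<close> counts the zeros that Rolle's theorem leaves
    to the rotated real part of the second derivative. For \<open>m = 1\<close> there are none, and
    the bound on \<open>H 2\<close> is \<open>M\<close> itself.\<close>
  obtain l where l: "m = Suc l" using m by (cases m) auto
  let ?e = "\<lambda>x. exp (\<i> * complex_of_real (\<kappa> * x))"
  have "continuous_on {c..d} (D 0)"
    by (rule continuous_on_vector_derivative[OF D]) simp
  then have "integral {c..d} (\<lambda>x. D 0 x * ?e x) - integral {c..d} (\<lambda>x. poly p (complex_of_real x) * ?e x)
      = integral {c..d} (\<lambda>x. H 0 x * ?e x)"
    by (subst integral_diff[symmetric])
      (auto intro!: integrable_continuous_interval continuous_intros simp: H_def algebra_simps)
  moreover have "norm (integral {c..d} (\<lambda>x. H 0 x * ?e x))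
      \<le> (2 * (M * (d - c) ^ m / fact m) + M * (d - c) ^ l / fact l * (d - c)) / \<kappa>\<^sup>2"
    using bound[of 1 m] bound[of 2 l] H0 X m l H[of 0] H[of 1]
    by (intro oscillatory_integral_bound[OF cd \<kappa>, of "H 0" "H 1" "H 2"])
      (auto simp: numeral_2_eq_2)
  \<comment> \<open>Rewriting \<open>1 / (m - 1)!\<close> as \<open>m / m!\<close> merges the
    boundary terms and the integral term into the factor \<open>m + 2\<close>.\<close>
  moreover have "M * (d - c) ^ l / fact l * (d - c) = real m * (M * (d - c) ^ m / fact m)"
    by (simp add: l divide_simps)
  then have "(2 * (M * (d - c) ^ m / fact m) + M * (d - c) ^ l / fact l * (d - c)) / \<kappa>\<^sup>2
      = (real m + 2) / (fact m * \<kappa>\<^sup>2) * M * (d - c) ^ m"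
    using \<kappa> by (simp add: field_simps)
  ultimately show ?thesis by simp
qed

section \<open>Derivatives within a set and the maximum norm\<close>

lemma C_k_on_has_vector_derivative:
  assumes "C_k_on k S h" "i < k" "x \<in> S"
  shows "(nth_deriv_on i S h has_vector_derivative nth_deriv_on (Suc i) S h x) (at x within S)"
  using assms by (auto simp: C_k_on_def vector_derivative_works)

lemma norm_le_max_norm:
  assumes "continuous_on S h" "compact S" "x \<in> S"
  shows "norm (h x) \<le> max_norm S h"
  unfolding max_norm_def
proof (rule cSUP_upper[OF assms(3)])
  have "compact ((\<lambda>x. norm (h x)) ` S)"
    using assms by (intro compact_continuous_image continuous_on_norm)
  then show "bdd_above ((\<lambda>x. norm (h x)) ` S)"
    by (rule compact_imp_bounded[THEN bounded_imp_bdd_above])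
qed

lemma max_norm_nonneg:
  assumes "continuous_on S h" "compact S" "S \<noteq> {}"
  shows "0 \<le> max_norm S h"
  using norm_le_max_norm[OF assms(1,2)] assms(3) by (meson all_not_in_conv norm_ge_zero order_trans)

section \<open>Nodes, meshes and the number of evaluations\<close>

lemma filon_nodes_less:
  assumes "filon_nodes m a b t" "i < j" "j \<le> m"
  shows "t i < t j"
  using assms(2,3)
proof (induction j)
  case (Suc j)
  then have "t j < t (Suc j)" using assms(1) by (auto simp: filon_nodes_def)
  then show ?case using Suc by (cases "i = j") auto
qed simp

lemma filon_nodes_in_interval:
  assumes "filon_nodes m a b t" "i \<le> m"
  shows "t i \<in> {a..b}"
proof -
  have "t 0 \<le> t i" "t i \<le> t m"
    using filon_nodes_less[OF assms(1)] assms(2)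
    by (cases "i = 0"; cases "i = m"; force simp: less_imp_le)+
  then show ?thesis using assms(1) by (simp add: filon_nodes_def)
qed

lemma filon_nodes_inj: "filon_nodes m a b t \<Longrightarrow> inj_on t {..m}"
  by (auto intro!: linorder_inj_onI' dest: filon_nodes_less)

lemma uniform_mesh_0: "uniform_mesh a b N 0 = a"
  by (simp add: uniform_mesh_def)

lemma uniform_mesh_N: "1 \<le> N \<Longrightarrow> uniform_mesh a b N N = b"
  by (simp add: uniform_mesh_def)

lemma uniform_mesh_mono:
  assumes "a \<le> b" "i \<le> j"
  shows "uniform_mesh a b N i \<le> uniform_mesh a b N j"
  using assms by (simp add: uniform_mesh_def mult_left_mono divide_right_mono)

lemma uniform_mesh_step:
  assumes "1 \<le> j"
  shows "uniform_mesh a b N j - uniform_mesh a b N (j - 1) = (b - a) / N"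
  using assms by (simp add: uniform_mesh_def diff_divide_distrib[symmetric] algebra_simps)

text \<open>Each subinterval after the first contributes at most \<open>m\<close> new points,
  because its first node is the last node of its predecessor.\<close>

lemma composite_eval_count_le:
  assumes "composite_nodes N m a b t"
  shows "composite_eval_count N m t g \<le> N * m + 1"
proof -
  let ?P = "\<lambda>j. eval_points m (t j) g"
  have "card (\<Union>j\<in>{1..n}. ?P j) \<le> n * m + 1" if "n \<le> N" for n
    using that
  proof (induction n)
    case (Suc n)
    let ?U = "\<Union>j\<in>{1..n}. ?P j" and ?V = "(\<lambda>i. g (t (Suc n) i)) ` {1..m}"
    have fin: "finite ?U" by (auto simp: eval_points_def)
    have P: "?P (Suc n) = insert (g (t (Suc n) 0)) ?V"
      unfolding eval_points_def by (auto simp: image_iff) (metis One_nat_def Suc_leI atLeastAtMost_iff neq0_conv)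
    have V: "card ?V \<le> m" by (rule order_trans[OF card_image_le]) auto
    show ?case
    \<comment> \<open>The first subinterval has no predecessor; its initial node accounts for the
      summand 1.\<close>
    proof (cases "n = 0")
      case True
      then show ?thesis using P V by (simp add: card_insert_if)
    next
      case False
      have "t (Suc n) 0 = t n m"
        using assms Suc.prems False by (force simp: composite_nodes_def filon_nodes_def)
      then have "g (t (Suc n) 0) \<in> ?P n" by (simp add: eval_points_def)
      then have "g (t (Suc n) 0) \<in> ?U" using False by auto
      then have "(\<Union>j\<in>{1..Suc n}. ?P j) = ?U \<union> ?V"
        using P by (auto simp: atLeastAtMostSuc_conv)
      also have "card \<dots> \<le> card ?U + card ?V" by (rule card_Un_le)
      finally show ?thesis using Suc V by simp
    qed
  qed simp
  then show ?thesis by (simp add: composite_eval_count_def)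
qed

section \<open>Change of variables by \<open>g\<close> and the composite rule\<close>

locale filon_integral =
  fixes a b :: real and f :: "real \<Rightarrow> complex" and g :: "real \<Rightarrow> real"
  assumes ab: "a < b"
    and cont_f: "continuous_on {a..b} f"
    and C1_g: "C_k_on 1 {a..b} g"
    and mono_g: "strict_mono_on {a..b} g"
    and nonstationary: "\<forall>x\<in>{a..b}. nth_deriv_on 1 {a..b} g x \<noteq> 0"
begin

abbreviation "g' \<equiv> nth_deriv_on 1 {a..b} g"

lemma deriv_g:
  assumes "x \<in> S" "S \<subseteq> {a..b}"
  shows "(g has_real_derivative g' x) (at x within S)"
proof -
  have "(g has_vector_derivative g' x) (at x within {a..b})"
    using C_k_on_has_vector_derivative[OF C1_g, of 0 x] assms by auto
  then show ?thesis
    unfolding has_real_derivative_iff_has_vector_derivative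
    using assms(2) by (rule has_vector_derivative_within_subset)
qed

lemma cont_deriv_g: "continuous_on {a..b} g'"
  using C1_g by (simp only: C_k_on_def)

text \<open>Positivity ensures that the ceiling of \<sigma> is at least 1, hence an admissible
  number of subintervals.\<close>

lemma max_norm_deriv_pos: "0 < max_norm {a..b} g'"
proof -
  have "norm (g' a) \<le> max_norm {a..b} g'"
    using ab by (intro norm_le_max_norm cont_deriv_g) auto
  moreover have "0 < norm (g' a)" using nonstationary ab by simp
  ultimately show ?thesis by linarith
qed

lemma cont_g: "continuous_on {a..b} g"
  by (rule DERIV_continuous_on[OF deriv_g]) auto

lemma g_image:
  assumes "x \<in> {c..d}" "{c..d} \<subseteq> {a..b}"
  shows "g x \<in> {g c..g d}"
proof -
  have "c \<in> {a..b}" "d \<in> {a..b}" using assms by auto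
  then show ?thesis
    using assms strict_mono_on_leD[OF mono_g] by auto
qed

text \<open>The right-hand side is independent of \<open>c\<close> and \<open>d\<close>. Thus the
  amplitude used by the rule on a subinterval, with \<open>g\<close> inverted and differentiated
  there, agrees with the global \<Psi>. Nondegeneracy \<open>c < d\<close> makes the derivative
  within \<open>{c..d}\<close> unique.\<close>

lemma filon_amplitude_g:
  assumes "c < d" "{c..d} \<subseteq> {a..b}" "x \<in> {c..d}"
  shows "filon_amplitude c d f g (g x) = f x / g' x"
proof -
  have "inj_on g {c..d}"
    using strict_mono_on_imp_inj_on[OF mono_g] assms(2) inj_on_subset by blast
  moreover have "nth_deriv_on 1 {c..d} g x = g' x"
    using deriv_g[OF assms(3,2)] vector_derivative_within_closed_interval[OF assms(1,3)]
    by (simp add: has_real_derivative_iff_has_vector_derivative)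
  ultimately show ?thesis using assms(3) by (simp add: filon_amplitude_def)
qed

text \<open>The factor \<open>g'\<close> from the substitution cancels the denominator of \<Psi>.
  Keeping the global amplitude lets one smooth function serve all subintervals.\<close>

lemma osc_integral_substitution:
  assumes "c < d" "{c..d} \<subseteq> {a..b}"
    and cont: "continuous_on {g a..g b} (filon_amplitude a b f g)"
  shows "osc_integral \<kappa> c d f g
    = integral {g c..g d} (\<lambda>x. filon_amplitude a b f g x * exp (\<i> * complex_of_real (\<kappa> * x)))"
proof -
  let ?F = "\<lambda>x. filon_amplitude a b f g x * exp (\<i> * complex_of_real (\<kappa> * x))"
  have sub: "{g c..g d} \<subseteq> {g a..g b}"
    using g_image[of c a b] g_image[of d a b] assms by auto
  have "((\<lambda>x. g' x *\<^sub>R ?F (g x)) has_integral integral {g c..g d} ?F) {c..d}"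
    using assms deriv_g g_image[of _ c d] g_image[of c c d]
    by (intro has_integral_substitution[where c = "g c" and d = "g d"])
      (auto intro!: continuous_intros intro: continuous_on_subset[OF cont sub])
  moreover have "g' x *\<^sub>R ?F (g x) = f x * exp (\<i> * complex_of_real (\<kappa> * g x))"
    if "x \<in> {c..d}" for x
    using that assms(2) nonstationary filon_amplitude_g[OF ab, of x]
    by (auto simp: scaleR_conv_of_real)
  ultimately have "((\<lambda>x. f x * exp (\<i> * complex_of_real (\<kappa> * g x))) has_integral
      integral {g c..g d} ?F) {c..d}"
    by (rule has_integral_eq[rotated])
  then show ?thesis by (simp add: osc_integral_def integral_unique)
qed

text \<open>As \<open>g\<close> is injective, the \<open>m + 1\<close> nodes have distinct images,
  among them both ends \<open>g c\<close> and \<open>g d\<close>, so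
  \<open>filon_interval_error\<close> applies on \<open>{g c..g d}\<close>.\<close>

lemma filon_rule_error:
  assumes m: "1 \<le> m" and \<kappa>: "0 < \<kappa>" and cd: "c < d" "{c..d} \<subseteq> {a..b}"
    and \<Psi>: "C_k_on (m + 1) {g a..g b} \<Psi>" "\<Psi> = filon_amplitude a b f g"
    and t: "filon_nodes m c d t"
  shows "norm (osc_integral \<kappa> c d f g - filon_rule \<kappa> m c d t f g)
    \<le> (real m + 2) / (fact m * \<kappa>\<^sup>2)
        * max_norm {g a..g b} (nth_deriv_on (m + 1) {g a..g b} \<Psi>) * (g d - g c) ^ m"
proof -
  let ?I = "{g a..g b}" and ?X = "eval_points m t g"
  let ?D = "\<lambda>i. nth_deriv_on i ?I \<Psi>"
  have sub: "{g c..g d} \<subseteq> ?I"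
    using g_image[of c a b] g_image[of d a b] cd by auto
  have tcd: "t i \<in> {c..d}" if "i \<le> m" for i using filon_nodes_in_interval[OF t that] .
  have "inj_on g {c..d}"
    using strict_mono_on_imp_inj_on[OF mono_g] cd(2) inj_on_subset by blast
  then have "inj_on (\<lambda>i. g (t i)) {..m}"
    using filon_nodes_inj[OF t] tcd by (auto simp: inj_on_def)
  then have X: "card ?X = m + 1" by (simp add: eval_points_def card_image)
  let ?p = "interp_poly m ?X (filon_amplitude c d f g)"
  have p: "degree ?p \<le> m" "poly ?p (complex_of_real x) = ?D 0 x" if x: "x \<in> ?X" for x
  proof -
    show "degree ?p \<le> m" by (rule interp_poly_properties[OF X])
    obtain i where i: "i \<le> m" "x = g (t i)" using x by (auto simp: eval_points_def)
    then show "poly ?p (complex_of_real x) = ?D 0 x"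
      using interp_poly_properties(2)[OF X x, of "filon_amplitude c d f g"] tcd[OF i(1)]
        filon_amplitude_g[OF cd, of "t i"] filon_amplitude_g[OF ab, of "t i"] cd \<Psi>(2) by auto
  qed
  have ends: "g c \<in> ?X" "g d \<in> ?X"
    using t by (auto simp: eval_points_def filon_nodes_def)
  have cont: "continuous_on ?I (?D (m + 1))" using \<Psi>(1) by (simp only: C_k_on_def)
  have D: "(?D i has_vector_derivative ?D (Suc i) x) (at x within {g c..g d})"
    if "i < m + 1" "x \<in> {g c..g d}" for i x
    using C_k_on_has_vector_derivative[OF \<Psi>(1), of i x] that sub
    by (auto intro: has_vector_derivative_within_subset)
  have bound: "norm (?D (m + 1) x) \<le> max_norm ?I (?D (m + 1))" if "x \<in> {g c..g d}" for x
    using that sub by (intro norm_le_max_norm cont) auto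
  have "continuous_on ?I (?D 0)"
    by (rule continuous_on_vector_derivative[OF C_k_on_has_vector_derivative[OF \<Psi>(1)]]) auto
  then have osc: "osc_integral \<kappa> c d f g
      = integral {g c..g d} (\<lambda>x. ?D 0 x * exp (\<i> * complex_of_real (\<kappa> * x)))"
    using osc_integral_substitution[OF cd] \<Psi>(2) by simp
  have "g c \<le> g d" using g_image[of c c d] cd by auto
  moreover have "?X \<subseteq> {g c..g d}"
    using tcd g_image[OF _ cd(2)] unfolding eval_points_def by blast
  ultimately show ?thesis
    unfolding osc filon_rule_def
    using filon_interval_error[OF m _ \<kappa> D bound _ X ends p(1) p(2)] ends by blast
qed

text \<open>The mean value inequality; it is the source of the factor \<open>\<sigma> ^ m\<close> in
  the error bound.\<close>

lemma g_diff_le: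
  assumes "c \<le> d" "{c..d} \<subseteq> {a..b}"
  shows "g d - g c \<le> max_norm {a..b} g' * (d - c)"
proof -
  have "norm (g d - g c) \<le> max_norm {a..b} g' * norm (d - c)"
    using assms
    by (intro field_differentiable_bound[of "{c..d}" g g'] deriv_g norm_le_max_norm cont_deriv_g) auto
  then show ?thesis using assms(1) by simp
qed

lemma osc_integral_uniform_mesh:
  assumes "1 \<le> N"
  shows "osc_integral \<kappa> a b f g
    = (\<Sum>j=1..N. osc_integral \<kappa> (uniform_mesh a b N (j - 1)) (uniform_mesh a b N j) f g)"
proof -
  let ?y = "uniform_mesh a b N" and ?F = "\<lambda>x. f x * exp (\<i> * complex_of_real (\<kappa> * g x))"
  have F: "?F integrable_on {a..b}"
    using cont_f cont_g by (intro integrable_continuous_interval continuous_intros)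
  have "osc_integral \<kappa> a (?y n) f g = (\<Sum>j=1..n. osc_integral \<kappa> (?y (j - 1)) (?y j) f g)"
    if "n \<le> N" for n
    using that
  proof (induction n)
    case 0
    then show ?case by (simp add: uniform_mesh_0 osc_integral_def)
  next
    case (Suc n)
    have y: "a \<le> ?y n" "?y n \<le> ?y (Suc n)" "?y (Suc n) \<le> b"
      using uniform_mesh_mono[of a b 0 n N] uniform_mesh_mono[of a b n "Suc n" N]
        uniform_mesh_mono[of a b "Suc n" N N] ab Suc.prems assms
      by (auto simp: uniform_mesh_0 uniform_mesh_N)
    have "?F integrable_on {a..?y (Suc n)}"
      using F y by (auto intro: integrable_subinterval_real)
    from Henstock_Kurzweil_Integration.integral_combine[OF y(1,2) this] show ?case
      using Suc by (simp add: osc_integral_def)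
  qed
  from this[of N] show ?thesis using assms by (simp add: uniform_mesh_N)
qed

text \<open>Each of the \<open>N\<close> local errors carries \<open>1 / N ^ m\<close>, and
  summation loses one power of \<open>N\<close>.\<close>

lemma composite_filon_rule_error:
  assumes m: "1 \<le> m" and \<kappa>: "0 < \<kappa>" and N: "1 \<le> N"
    and \<Psi>: "C_k_on (m + 1) {g a..g b} \<Psi>" "\<Psi> = filon_amplitude a b f g"
    and t: "composite_nodes N m a b t"
  shows "norm (osc_integral \<kappa> a b f g - composite_filon_rule N \<kappa> m a b t f g)
    \<le> 3 * (real m + 1) / (fact m * \<kappa>\<^sup>2 * real N ^ (m - 1))
        * max_norm {g a..g b} (nth_deriv_on (m + 1) {g a..g b} \<Psi>)
        * max_norm {a..b} g' ^ m * (b - a) ^ m"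
proof -
  let ?y = "uniform_mesh a b N"
  let ?M = "max_norm {g a..g b} (nth_deriv_on (m + 1) {g a..g b} \<Psi>)"
  let ?s = "max_norm {a..b} g'"
  let ?E = "\<lambda>j. osc_integral \<kappa> (?y (j - 1)) (?y j) f g - filon_rule \<kappa> m (?y (j - 1)) (?y j) (t j) f g"
  have M: "0 \<le> ?M"
    using \<Psi>(1) g_image[of a a b] ab
    by (intro max_norm_nonneg) (auto simp: C_k_on_def simp del: nth_deriv_on.simps)
  have E: "norm (?E j) \<le> (real m + 2) / (fact m * \<kappa>\<^sup>2) * ?M * (?s * ((b - a) / N)) ^ m"
    if "j \<in> {1..N}" for j
  proof -
    have step: "?y j - ?y (j - 1) = (b - a) / N" using that by (intro uniform_mesh_step) auto
    have "0 < (b - a) / N" using ab N by simp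
    then have less: "?y (j - 1) < ?y j" using step by linarith
    have sub: "{?y (j - 1)..?y j} \<subseteq> {a..b}"
      using uniform_mesh_mono[of a b 0 "j - 1" N] uniform_mesh_mono[of a b j N N] that ab N
      by (auto simp: uniform_mesh_0 uniform_mesh_N)
    have "norm (?E j) \<le> (real m + 2) / (fact m * \<kappa>\<^sup>2) * ?M * (g (?y j) - g (?y (j - 1))) ^ m"
      using t that by (intro filon_rule_error m \<kappa> less sub \<Psi>) (auto simp: composite_nodes_def)
    \<comment> \<open>Monotonicity of the power needs a nonnegative base, which
      \<open>g_image\<close> supplies.\<close>
    also have "\<dots> \<le> (real m + 2) / (fact m * \<kappa>\<^sup>2) * ?M * (?s * ((b - a) / N)) ^ m"
      using g_diff_le[OF less_imp_le[OF less] sub] g_image[OF _ sub, of "?y j"] less M step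
      by (intro mult_left_mono power_mono) auto
    finally show ?thesis .
  qed
  have s: "0 \<le> ?s" using max_norm_deriv_pos by simp
  define C where "C = (real m + 2) / (fact m * \<kappa>\<^sup>2) * ?M"
  have "norm (osc_integral \<kappa> a b f g - composite_filon_rule N \<kappa> m a b t f g) = norm (\<Sum>j=1..N. ?E j)"
    by (simp add: osc_integral_uniform_mesh[OF N] composite_filon_rule_def sum_subtractf)
  also have "\<dots> \<le> (\<Sum>j=1..N. C * (?s * ((b - a) / N)) ^ m)"
    unfolding C_def by (rule sum_norm_le[OF E])
  also have "\<dots> = C * (?s ^ m * (b - a) ^ m) * (N / real N ^ m)"
    by (simp only: sum_constant card_atLeastAtMost power_mult_distrib power_divide) simp
  also have "\<dots> = C * (?s ^ m * (b - a) ^ m) * (1 / real N ^ (m - 1))"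
    using m N by (cases m) auto
  also have "\<dots> = (real m + 2) * (?M * ?s ^ m * (b - a) ^ m / (fact m * \<kappa>\<^sup>2 * real N ^ (m - 1)))"
    by (simp add: C_def)
  also have "\<dots> \<le> 3 * (real m + 1) * (?M * ?s ^ m * (b - a) ^ m / (fact m * \<kappa>\<^sup>2 * real N ^ (m - 1)))"
    using M s ab by (intro mult_right_mono) auto
  finally show ?thesis by simp
qed

end

section \<open>The bounds for arbitrary \<open>N\<close> and for the ceiling of \<sigma>\<close>

theorem theorem2p1:
  fixes m :: nat and a b \<kappa> \<sigma> :: real
    and f :: "real \<Rightarrow> complex" and g :: "real \<Rightarrow> real" and \<Psi> :: "real \<Rightarrow> complex"
  assumes "1 \<le> m"
    and "a < b" and "{a..b} \<subseteq> {0..1}"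
    and "1 < \<kappa>"
    and "continuous_on {a..b} f"
    and "C_k_on 1 {a..b} g"
    and "strict_mono_on {a..b} g"
    and "\<forall>x\<in>{a..b}. nth_deriv_on 1 {a..b} g x \<noteq> 0"
    and "\<sigma> = max_norm {a..b} (nth_deriv_on 1 {a..b} g)"
    and "\<Psi> = filon_amplitude a b f g"
    and "C_k_on (m + 1) {g a..g b} \<Psi>"
  shows
    "(\<forall>N t. 1 \<le> N \<and> composite_nodes N m a b t \<longrightarrow>
        norm (osc_integral \<kappa> a b f g - composite_filon_rule N \<kappa> m a b t f g)
          \<le> 3 * (real m + 1) / (fact m * \<kappa>\<^sup>2 * real N ^ (m - 1))
             * max_norm {g a..g b} (nth_deriv_on (m + 1) {g a..g b} \<Psi>)
             * \<sigma> ^ m * (b - a) ^ m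
        \<and> composite_eval_count N m t g \<le> N * m + 1)
     \<and> (\<forall>N t. int N = \<lceil>\<sigma>\<rceil> \<and> composite_nodes N m a b t \<longrightarrow>
        norm (osc_integral \<kappa> a b f g - composite_filon_rule N \<kappa> m a b t f g)
          \<le> 3 * (real m + 1) / (fact m * \<kappa>\<^sup>2)
             * max_norm {g a..g b} (nth_deriv_on (m + 1) {g a..g b} \<Psi>)
             * \<sigma> * (b - a) ^ m)"
proof -
  interpret filon_integral a b f g
    using assms by unfold_locales
  let ?M = "max_norm {g a..g b} (nth_deriv_on (m + 1) {g a..g b} \<Psi>)"
  have error: "norm (osc_integral \<kappa> a b f g - composite_filon_rule N \<kappa> m a b t f g)
      \<le> 3 * (real m + 1) / (fact m * \<kappa>\<^sup>2 * real N ^ (m - 1)) * ?M * \<sigma> ^ m * (b - a) ^ m"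
    if "1 \<le> N" "composite_nodes N m a b t" for N t
    using composite_filon_rule_error[OF assms(1) _ that(1) assms(11,10) that(2), of \<kappa>] assms(4,9)
    by simp
  have "norm (osc_integral \<kappa> a b f g - composite_filon_rule N \<kappa> m a b t f g)
      \<le> 3 * (real m + 1) / (fact m * \<kappa>\<^sup>2) * ?M * \<sigma> * (b - a) ^ m"
    if N: "int N = \<lceil>\<sigma>\<rceil>" and t: "composite_nodes N m a b t" for N t
  proof -
    have \<sigma>: "0 < \<sigma>" using max_norm_deriv_pos assms(9) by simp
    then have N1: "1 \<le> N" and le: "\<sigma> \<le> real N" using N by linarith+
    have M: "0 \<le> ?M"
      using assms(11) g_image[of a a b] ab
      by (intro max_norm_nonneg) (auto simp: C_k_on_def simp del: nth_deriv_on.simps)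
    \<comment> \<open>One factor \<sigma> is split off; the other \<open>m - 1\<close> are each
      paired with a factor \<open>1 / N\<close>, and \<open>\<sigma> / N\<close> is at most
      1.\<close>
    have "\<sigma> ^ m / real N ^ (m - 1) = \<sigma> * (\<sigma> / real N) ^ (m - 1)"
      using assms(1) by (cases m) (auto simp: power_divide)
    also have "\<dots> \<le> \<sigma> * 1"
      using \<sigma> le N1 by (intro mult_left_mono power_le_one) auto
    finally have "\<sigma> ^ m / real N ^ (m - 1) \<le> \<sigma>" by simp
    then have "3 * (real m + 1) / (fact m * \<kappa>\<^sup>2) * ?M * (b - a) ^ m * (\<sigma> ^ m / real N ^ (m - 1))
        \<le> 3 * (real m + 1) / (fact m * \<kappa>\<^sup>2) * ?M * (b - a) ^ m * \<sigma>"
      using M ab by (intro mult_left_mono) auto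
    then show ?thesis using error[OF N1 t] by (simp add: mult_ac)
  qed
  then show ?thesis using error composite_eval_count_le by blast
qed

end
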